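(* Let $(Y_n)_n$, $(Y'_n)_n$ be two independent sequences of independent standard Gaussian random variables, let $(c_k)_{k\ge0}\in\ell^2$, and let $\{x_t\}_{t\in[0,1]}\in\mathscr{H}$ be the limit, in mean square and uniformly in $t$, of $$c_0Y'_0+\sum_{k=1}^{n}c_k\big(Y_k\sqrt2\sin(2k\pi t)+Y'_k\sqrt2\cos(2k\pi t)\big)\qquad(n\to\infty).$$ Let $0<\alpha\le1$. If $c_k^2=O\big(\frac{1}{k^{3+\alpha}}\big)$, then almost all trajectories of $\{x_t\}_{t\in[0,1]}$ are Lipschitz continuous and, as functions of $t$, have a continuous derivative $\{x'_t\}_{t\in[0,1]}$ that is Hölder continuous of order $\beta$, for $\beta<\frac{\alpha}{2}$.
   Context: $\mathscr{H}$ denotes the set of real Gaussian stochastic processes $\{x_t\}_{t\in[0,1]}$ such that: $E(x_t)=0$ for all $t$; the process is continuously stationary, i.e. its covariance function $C(s,t)=\mathrm{Cov}(x_s,x_t)$ satisfies $C(s,t)=\tilde C(s-t)$ for all $s,t$ for some real continuous function $\tilde C$ (the covariogram function); and the process is periodical, i.e. $x_0=x_1$ almost surely. Convergence in mean square, uniformly in $t$, of $S_n(t)$ to $x_t$ means $\sup_{t\in[0,1]}E\big[(x_t-S_n(t))^2\big]\to0$.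
   Formalization: The trajectory properties are proved for a modification of {x_t} (equal to x_t almost surely for each t), since a mean-square limit fixes the process only up to modification and the claim fails for arbitrary versions. *)

theory Defs
  imports
    "HOL-Probability.Probability"
    "HOL-Library.Landau_Symbols"
begin

text \<open>
  Constants count as Gaussian (variance zero); without this convention processes with
  degenerate covariance, e.g. with \<open>x 0 = x 1\<close> almost surely, would not be Gaussian.
\<close>

definition gaussian_rv :: "'a measure \<Rightarrow> ('a \<Rightarrow> real) \<Rightarrow> bool" where
  "gaussian_rv M X \<longleftrightarrow> X \<in> borel_measurable M \<and>
     ((\<exists>\<mu> \<sigma>. \<sigma> > 0 \<and> distributed M lborel X (normal_density \<mu> \<sigma>)) \<or>
      (\<exists>\<mu>. AE \<omega> in M. X \<omega> = \<mu>))"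

definition gaussian_process :: "'a measure \<Rightarrow> 't set \<Rightarrow> ('t \<Rightarrow> 'a \<Rightarrow> real) \<Rightarrow> bool" where
  "gaussian_process M T x \<longleftrightarrow>
     (\<forall>t\<in>T. x t \<in> borel_measurable M) \<and>
     (\<forall>J a. finite J \<and> J \<subseteq> T \<longrightarrow> gaussian_rv M (\<lambda>\<omega>. \<Sum>t\<in>J. a t * x t \<omega>))"

definition covariance :: "'a measure \<Rightarrow> ('a \<Rightarrow> real) \<Rightarrow> ('a \<Rightarrow> real) \<Rightarrow> real" where
  "covariance M X Y =
     (\<integral>\<omega>. (X \<omega> - (\<integral>\<omega>'. X \<omega>' \<partial>M)) * (Y \<omega> - (\<integral>\<omega>'. Y \<omega>' \<partial>M)) \<partial>M)"

text \<open>The class \<open>\<H>\<close>; the covariogram lives on \<open>{-1..1}\<close>, the set of differences \<open>s - t\<close>.\<close>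

definition process_class_H :: "'a measure \<Rightarrow> (real \<Rightarrow> 'a \<Rightarrow> real) \<Rightarrow> bool" where
  "process_class_H M x \<longleftrightarrow>
     gaussian_process M {0..1} x \<and>
     (\<forall>t\<in>{0..1}. (\<integral>\<omega>. x t \<omega> \<partial>M) = 0) \<and>
     (\<exists>C. continuous_on {-1..1} C \<and>
        (\<forall>s\<in>{0..1}. \<forall>t\<in>{0..1}. covariance M (x s) (x t) = C (s - t))) \<and>
     (AE \<omega> in M. x 0 \<omega> = x 1 \<omega>)"

definition iid_std_gaussian_seq :: "'a measure \<Rightarrow> (nat \<Rightarrow> 'a \<Rightarrow> real) \<Rightarrow> bool" where
  "iid_std_gaussian_seq M Y \<longleftrightarrow>
     prob_space.indep_vars M (\<lambda>_. borel) Y UNIV \<and>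
     (\<forall>n. distributed M lborel (Y n) std_normal_density)"

text \<open>Independence of two sequences as random elements of \<open>\<real>\<^sup>\<nat>\<close>.\<close>

definition indep_seqs :: "'a measure \<Rightarrow> (nat \<Rightarrow> 'a \<Rightarrow> real) \<Rightarrow> (nat \<Rightarrow> 'a \<Rightarrow> real) \<Rightarrow> bool" where
  "indep_seqs M Y Y' \<longleftrightarrow>
     prob_space.indep_var M
       (\<Pi>\<^sub>M n\<in>UNIV. borel) (\<lambda>\<omega> n. Y n \<omega>)
       (\<Pi>\<^sub>M n\<in>UNIV. borel) (\<lambda>\<omega> n. Y' n \<omega>)"

definition fourier_partial_sum ::
  "(nat \<Rightarrow> real) \<Rightarrow> (nat \<Rightarrow> 'a \<Rightarrow> real) \<Rightarrow> (nat \<Rightarrow> 'a \<Rightarrow> real) \<Rightarrow> nat \<Rightarrow> real \<Rightarrow> 'a \<Rightarrow> real" where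
  "fourier_partial_sum c Y Y' n t \<omega> =
     c 0 * Y' 0 \<omega> +
     (\<Sum>k=1..n. c k * (Y k \<omega> * sqrt 2 * sin (2 * real k * pi * t) +
                       Y' k \<omega> * sqrt 2 * cos (2 * real k * pi * t)))"

text \<open>
  Mean-square convergence, uniformly in the index. The second moments are taken as
  nonnegative extended integrals, so that neither the expectation nor the supremum can
  silently take a default value.
\<close>

definition ms_uniform_limit ::
  "'a measure \<Rightarrow> 't set \<Rightarrow> (nat \<Rightarrow> 't \<Rightarrow> 'a \<Rightarrow> real) \<Rightarrow> ('t \<Rightarrow> 'a \<Rightarrow> real) \<Rightarrow> bool" where
  "ms_uniform_limit M T S x \<longleftrightarrow>
     (\<lambda>n. SUP t\<in>T. \<integral>\<^sup>+\<omega>. ennreal ((x t \<omega> - S n t \<omega>)\<^sup>2) \<partial>M) \<longlonglongrightarrow> 0"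

text \<open>
  A process given as a mean-square limit is determined only up to modification, and
  path properties are properties of a suitable modification.
\<close>

definition modification ::
  "'a measure \<Rightarrow> 't set \<Rightarrow> ('t \<Rightarrow> 'a \<Rightarrow> real) \<Rightarrow> ('t \<Rightarrow> 'a \<Rightarrow> real) \<Rightarrow> bool" where
  "modification M T x y \<longleftrightarrow>
     (\<forall>t\<in>T. y t \<in> borel_measurable M \<and> (AE \<omega> in M. y t \<omega> = x t \<omega>))"

definition holder_on :: "real \<Rightarrow> real set \<Rightarrow> (real \<Rightarrow> real) \<Rightarrow> bool" where
  "holder_on \<beta> S f \<longleftrightarrow> (\<exists>K. \<forall>s\<in>S. \<forall>t\<in>S. \<bar>f s - f t\<bar> \<le> K * \<bar>s - t\<bar> powr \<beta>)"

end

theory Submission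
  imports Defs
begin

text \<open>
  Differentiating the random Fourier series termwise gives a series whose coefficients satisfy
  \<open>d\<^sub>k\<^sup>2 = O(1 / k powr (1 + \<alpha>))\<close>. Everything rests on grouping frequencies into dyadic blocks
  \<open>2\<^sup>j \<le> k < 2\<^sup>j\<^sup>+\<^sup>1\<close> and showing that almost surely the supremum over \<open>t\<close> of the \<open>j\<close>-th block of
  a series with \<open>a\<^sub>k\<^sup>2 = O(1 / k powr r)\<close> decays like \<open>2 powr (- \<gamma> j)\<close>, for every
  \<open>\<gamma> < (r - 1) / 2\<close>.

  At a fixed \<open>t\<close> this decay is immediate: the block is a centred Gaussian variable of variance
  \<open>O(2 powr ((1 - r) j))\<close>, so all its moments are of the matching order
  (\<open>gaussian_linear_combination_moment\<close>). To pass to the supremum, a \<open>C\<^sup>1\<close> function on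
  \<open>{0..1}\<close> satisfies \<open>sup \<bar>f\<bar>\<^sup>p \<le> (p + 1) N \<integral> (\<bar>f\<bar>\<^sup>p + \<bar>f' / N\<bar>\<^sup>p)\<close> for \<open>N \<ge> 1\<close>
  (\<open>even_power_sup_le_integral\<close>). The derivative of a block at frequency \<open>N = 2\<^sup>j\<close> is \<open>N\<close> times
  a block of the same kind, so the supremum costs only the factor \<open>N\<close>; after taking
  \<open>p\<close>-th roots with \<open>p\<close> large this factor is negligible. Summing the expected \<open>p\<close>-th powers
  over \<open>j\<close> turns the estimate into an almost sure one (\<open>AE_trig_block_decay\<close>).

  Applied to the series (\<open>r = 3 + \<alpha>\<close>), its first derivative (\<open>r = 1 + \<alpha>\<close>) and its second formal
  derivative (\<open>r = \<alpha> - 1\<close>), this gives, almost surely, uniform convergence of the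
  sum of the blocks of the first derivative, hence a \<open>C\<^sup>1\<close> limit.
  The blocks \<open>g\<^sub>j\<close> of the first derivative satisfy
  \<open>\<bar>g\<^sub>j\<bar> \<le> K 2 powr (- \<gamma> j)\<close> and \<open>\<bar>g\<^sub>j'\<bar> \<le> K 2 powr ((1 - \<gamma>) j)\<close> for each \<open>\<gamma> < \<alpha> / 2\<close>;
  interpolating between the two bounds shows that the sum is Hoelder continuous of every order
  \<open>\<beta> < \<gamma>\<close> (\<open>holder_on_suminf_dyadic\<close>).

  The sine and the cosine series are treated separately, as instances of one series with a phase
  \<open>\<theta>\<close>, so that each involves a single independent sequence. The sum of the two limits
  agrees almost surely with the given process at each \<open>t\<close> because the dyadic partial sums
  converge to the former almost surely and to the latter in mean square.
\<close>

section \<open>Moments of Gaussian linear combinations\<close>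

text \<open>
  The linear combination is again normal, so only its variance matters. Vanishing coefficients
  have to be dropped first, since a normal density needs positive standard deviation.
\<close>

lemma gaussian_linear_combination_moment:
  assumes "prob_space M" and Y: "iid_std_gaussian_seq M Y" and "finite I"
  shows "(\<integral>\<^sup>+\<omega>. ennreal ((\<Sum>k\<in>I. a k * Y k \<omega>) ^ (2 * m)) \<partial>M)
    = ennreal (fact (2 * m) / (2 ^ m * fact m) * (\<Sum>k\<in>I. (a k)\<^sup>2) ^ m)"
proof -
  interpret prob_space M by fact
  define J where "J = {k\<in>I. a k \<noteq> 0}"
  have J: "finite J" "J \<subseteq> I" using \<open>finite I\<close> by (auto simp: J_def)
  have sum_eq: "(\<Sum>k\<in>I. a k * Y k \<omega>) = (\<Sum>k\<in>J. a k * Y k \<omega>)" for \<omega>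
    by (rule sum.mono_neutral_right) (use \<open>finite I\<close> in \<open>auto simp: J_def\<close>)
  have var_eq: "(\<Sum>k\<in>I. (a k)\<^sup>2) = (\<Sum>k\<in>J. (a k)\<^sup>2)"
    by (rule sum.mono_neutral_right) (use \<open>finite I\<close> in \<open>auto simp: J_def\<close>)
  show ?thesis
  proof (cases "J = {}")
    case True
    then show ?thesis
      unfolding sum_eq var_eq by (cases m) (simp_all add: emeasure_space_1)
  next
    case False
    define \<sigma> where "\<sigma> = sqrt (\<Sum>k\<in>J. (a k)\<^sup>2)"
    have pos: "(\<Sum>k\<in>J. (a k)\<^sup>2) > 0"
      using J False by (intro sum_pos) (auto simp: J_def)
    then have \<sigma>: "\<sigma> > 0" and \<sigma>2: "\<sigma>\<^sup>2 = (\<Sum>k\<in>J. (a k)\<^sup>2)" by (auto simp: \<sigma>_def)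
    have indep: "indep_vars (\<lambda>_. borel) Y UNIV" and
      normal: "\<And>n. distributed M lborel (Y n) std_normal_density"
      using Y by (auto simp: iid_std_gaussian_seq_def)
    have "indep_vars (\<lambda>_. borel) (\<lambda>k \<omega>. a k * Y k \<omega>) J"
      by (rule indep_vars_compose2[OF indep_vars_subset[OF indep]]) auto
    moreover have "distributed M lborel (\<lambda>\<omega>. a k * Y k \<omega>) (normal_density 0 \<bar>a k\<bar>)"
      if "k \<in> J" for k
      using normal_density_affine[OF normal[of k], of "a k" 0] that by (simp add: J_def)
    ultimately have "distributed M lborel (\<lambda>\<omega>. \<Sum>k\<in>J. a k * Y k \<omega>)
        (normal_density (\<Sum>k\<in>J. 0) (sqrt (\<Sum>k\<in>J. \<bar>a k\<bar>\<^sup>2)))"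
      using J False by (intro sum_indep_normal) (auto simp: J_def)
    then have dist: "distributed M lborel (\<lambda>\<omega>. \<Sum>k\<in>J. a k * Y k \<omega>) (normal_density 0 \<sigma>)"
      by (simp add: \<sigma>_def)
    have "(\<integral>\<^sup>+\<omega>. ennreal ((\<Sum>k\<in>J. a k * Y k \<omega>) ^ (2 * m)) \<partial>M)
        = (\<integral>\<^sup>+z. ennreal (normal_density 0 \<sigma> z) * ennreal (z ^ (2 * m)) \<partial>lborel)"
      by (rule distributed_nn_integral[OF dist, symmetric]) simp
    also have "\<dots> = (\<integral>\<^sup>+z. ennreal (normal_density 0 \<sigma> z * (z - 0) ^ (2 * m)) \<partial>lborel)"
      by (simp add: ennreal_mult')
    also have "\<dots> = ennreal (fact (2 * m) / ((2 / \<sigma>\<^sup>2) ^ m * fact m))"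
      using normal_moment_even[OF \<sigma>, of 0 m]
      by (intro nn_integral_eq_integral[THEN trans]) (auto simp: has_bochner_integral_iff)
    also have "fact (2 * m) / ((2 / \<sigma>\<^sup>2) ^ m * fact m) = fact (2 * m) / (2 ^ m * fact m) * (\<sigma>\<^sup>2) ^ m"
      using \<sigma> by (simp add: power_divide)
    finally show ?thesis unfolding sum_eq var_eq \<sigma>2 .
  qed
qed

section \<open>A Sobolev inequality on the unit interval\<close>

text \<open>
  The increment of \<open>f\<^sup>2\<^sup>m\<close> is the integral of \<open>2m f\<^sup>2\<^sup>m\<^sup>-\<^sup>1 f'\<close>, and the modulus of
  \<open>f\<^sup>2\<^sup>m\<^sup>-\<^sup>1 f'\<close> is at most \<open>N\<close> times the \<open>2m\<close>-th power of the larger of \<open>\<bar>f\<bar>\<close> and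
  \<open>\<bar>f' / N\<bar>\<close>; comparison with a minimum point of \<open>f\<^sup>2\<^sup>m\<close>, where the value is at most the mean,
  gives the bound. The scale \<open>N\<close> is free so that it can be matched to the frequency of \<open>f\<close>, which makes both summands on the
  right comparable in size.
\<close>

lemma even_power_sup_le_integral:
  fixes f f' :: "real \<Rightarrow> real"
  assumes deriv: "\<And>s. s \<in> {0..1} \<Longrightarrow> (f has_real_derivative f' s) (at s within {0..1})"
    and cont: "continuous_on {0..1} f'" and N: "1 \<le> N" and t: "t \<in> {0..1}"
  shows "f t ^ (2 * m) \<le> real (2 * m + 1) * N * integral {0..1} (\<lambda>s. f s ^ (2 * m) + (f' s / N) ^ (2 * m))"
proof -
  define h where "h s = f s ^ (2 * m) + (f' s / N) ^ (2 * m)" for s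
  define H where "H = integral {0..1} h"
  have contf: "continuous_on {0..1} f"
    using deriv by (rule DERIV_continuous_on)
  have conth: "continuous_on {0..1} h"
    unfolding h_def using N by (intro continuous_intros contf cont) auto
  have inth: "h integrable_on {a..b}" if "a \<in> {0..1}" "b \<in> {0..1}" for a b
    by (rule integrable_continuous_real, rule continuous_on_subset[OF conth]) (use that in auto)
  have h0: "0 \<le> h s" for s by (simp add: h_def)
  have pw: "\<bar>2 * m * f s ^ (2 * m - 1) * f' s\<bar> \<le> 2 * m * N * h s" for s
  proof (cases "m = 0")
    case False
    define u v where "u = \<bar>f s\<bar>" and "v = \<bar>f' s / N\<bar>"
    have uv: "0 \<le> u" "0 \<le> v" by (auto simp: u_def v_def)
    have "u ^ (2 * m - 1) * v \<le> max u v ^ (2 * m - 1) * max u v"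
      by (intro mult_mono power_mono) (use uv in auto)
    also have "\<dots> = max u v ^ (2 * m)"
      using False by (metis One_nat_def Suc_pred mult_is_0 neq0_conv power_Suc2 zero_neq_numeral)
    also have "\<dots> \<le> u ^ (2 * m) + v ^ (2 * m)"
      using uv by (auto simp: max_def)
    also have "\<dots> = h s" by (simp add: u_def v_def h_def power_even_abs del: abs_divide)
    finally have "2 * m * N * (u ^ (2 * m - 1) * v) \<le> 2 * m * N * h s"
      using N by (intro mult_left_mono) auto
    moreover have "\<bar>2 * m * f s ^ (2 * m - 1) * f' s\<bar> = 2 * m * N * (u ^ (2 * m - 1) * v)"
      using N by (simp add: u_def v_def abs_mult power_abs)
    ultimately show ?thesis by simp
  qed simp
  have incr: "f b ^ (2 * m) - f a ^ (2 * m) \<le> 2 * m * N * H \<and> f a ^ (2 * m) - f b ^ (2 * m) \<le> 2 * m * N * H"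
    if ab: "a \<le> b" "a \<in> {0..1}" "b \<in> {0..1}" for a b
  proof -
    have FTC: "((\<lambda>s. 2 * m * f s ^ (2 * m - 1) * f' s) has_integral (f b ^ (2 * m) - f a ^ (2 * m))) {a..b}"
    proof (rule fundamental_theorem_of_calculus[OF ab(1)])
      fix s assume s: "s \<in> {a..b}"
      then have d: "(f has_real_derivative f' s) (at s within {a..b})"
        using ab by (intro DERIV_subset[OF deriv]) auto
      show "((\<lambda>s. f s ^ (2 * m)) has_vector_derivative 2 * m * f s ^ (2 * m - 1) * f' s)
              (at s within {a..b})"
        unfolding has_real_derivative_iff_has_vector_derivative[symmetric]
        by (rule derivative_eq_intros d refl | simp)+
    qed
    have "\<bar>f b ^ (2 * m) - f a ^ (2 * m)\<bar> \<le> integral {a..b} (\<lambda>s. 2 * m * N * h s)"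
      using integral_norm_bound_integral[OF has_integral_integrable[OF FTC], of "\<lambda>s. 2 * m * N * h s"]
        integral_unique[OF FTC] pw integrable_on_cmult_left[OF inth[OF ab(2,3)]] by auto
    also have "\<dots> = 2 * m * N * integral {a..b} h" by simp
    also have "\<dots> \<le> 2 * m * N * H"
      unfolding H_def using N ab h0
      by (intro mult_left_mono integral_subset_le inth) auto
    finally show ?thesis by auto
  qed
  have "\<exists>s\<in>{0..1}. \<forall>u\<in>{0..1}. f s ^ (2 * m) \<le> f u ^ (2 * m)"
    by (rule continuous_attains_inf) (auto intro!: continuous_intros contf)
  then obtain s where s: "s \<in> {0..1}" "\<And>u. u \<in> {0..1} \<Longrightarrow> f s ^ (2 * m) \<le> f u ^ (2 * m)"
    by blast
  have "f s ^ (2 * m) = integral {0..1} (\<lambda>u::real. f s ^ (2 * m))" by simp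
  also have "\<dots> \<le> H"
    unfolding H_def
  proof (rule integral_le)
    fix u :: real assume "u \<in> {0..1}"
    with s(2)[OF this] show "f s ^ (2 * m) \<le> h u" by (simp add: h_def add_increasing2)
  qed (use inth[of 0 1] in auto)
  finally have "f s ^ (2 * m) \<le> 1 * H" by simp
  also have "\<dots> \<le> N * H"
    unfolding H_def using N h0 by (intro mult_right_mono integral_nonneg inth) auto
  moreover have "f t ^ (2 * m) - f s ^ (2 * m) \<le> 2 * m * N * H"
    using incr[of s t] incr[of t s] s(1) t by (cases "s \<le> t") auto
  ultimately show ?thesis by (simp add: H_def h_def[abs_def] algebra_simps)
qed

section \<open>Dyadic blocks of a trigonometric series\<close>

text \<open>
  A pure sine with a phase \<open>\<theta>\<close> covers both halves of the Fourier series (\<open>\<theta> = 0\<close> and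
  \<open>\<theta> = pi / 2\<close>) and is closed under differentiation, which multiplies the coefficients by
  \<open>2 \<pi> k\<close> and shifts the phase by \<open>pi / 2\<close>.
\<close>

definition trig_block :: "(nat \<Rightarrow> real) \<Rightarrow> real \<Rightarrow> (nat \<Rightarrow> real) \<Rightarrow> nat \<Rightarrow> real \<Rightarrow> real" where
  "trig_block a \<theta> z j t = (\<Sum>k\<in>{2^j..<2^Suc j}. a k * z k * sin (2 * real k * pi * t + \<theta>))"

definition freq_mult :: "(nat \<Rightarrow> real) \<Rightarrow> nat \<Rightarrow> real" where
  "freq_mult a k = 2 * pi * real k * a k"

lemma has_real_derivative_trig_block:
  "(trig_block a \<theta> z j has_real_derivative trig_block (freq_mult a) (\<theta> + pi / 2) z j t) (at t within S)"
  unfolding trig_block_def freq_mult_def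
  by (auto intro!: derivative_eq_intros sum.cong simp: sin_add cos_add algebra_simps)

lemma continuous_on_trig_block: "continuous_on S (trig_block a \<theta> z j)"
  using has_real_derivative_trig_block by (rule DERIV_continuous_on)

lemma trig_block_divide: "trig_block a \<theta> z j t / c = trig_block (\<lambda>k. a k / c) \<theta> z j t"
  by (simp add: trig_block_def sum_divide_distrib)

lemma measurable_trig_block [measurable]:
  assumes [measurable]: "\<And>k. Y k \<in> borel_measurable M"
  shows "(\<lambda>\<omega>. trig_block a \<theta> (\<lambda>k. Y k \<omega>) j t) \<in> borel_measurable M"
    and "(\<lambda>(t, \<omega>). trig_block a \<theta> (\<lambda>k. Y k \<omega>) j t) \<in> borel_measurable (lborel \<Otimes>\<^sub>M M)"
    and "(\<lambda>(\<omega>, t). trig_block a \<theta> (\<lambda>k. Y k \<omega>) j t) \<in> borel_measurable (M \<Otimes>\<^sub>M lborel)"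
  unfolding trig_block_def by measurable

lemma iid_std_gaussian_seq_measurable:
  assumes "iid_std_gaussian_seq M Y"
  shows "Y k \<in> borel_measurable M"
  using assms by (auto simp: iid_std_gaussian_seq_def distributed_def)

lemma trig_block_moment_le:
  assumes "prob_space M" "iid_std_gaussian_seq M Y"
  shows "(\<integral>\<^sup>+\<omega>. ennreal (trig_block a \<theta> (\<lambda>k. Y k \<omega>) j t ^ (2 * m)) \<partial>M)
    \<le> ennreal (fact (2 * m) / (2 ^ m * fact m) * (\<Sum>k\<in>{2^j..<2^Suc j}. (a k)\<^sup>2) ^ m)"
proof -
  have eq: "trig_block a \<theta> (\<lambda>k. Y k \<omega>) j t
      = (\<Sum>k\<in>{2^j..<2^Suc j}. (a k * sin (2 * real k * pi * t + \<theta>)) * Y k \<omega>)" for \<omega>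
    by (simp add: trig_block_def mult_ac)
  have "(\<Sum>k\<in>{2^j..<2^Suc j}. (a k * sin (2 * real k * pi * t + \<theta>))\<^sup>2)
      \<le> (\<Sum>k\<in>{2^j..<2^Suc j}. (a k)\<^sup>2)"
  proof (rule sum_mono)
    fix k
    have "(sin (2 * real k * pi * t + \<theta>))\<^sup>2 \<le> 1" by (simp add: abs_square_le_1)
    then show "(a k * sin (2 * real k * pi * t + \<theta>))\<^sup>2 \<le> (a k)\<^sup>2"
      by (simp add: power_mult_distrib mult_left_le)
  qed
  then show ?thesis
    unfolding eq using assms
    by (subst gaussian_linear_combination_moment)
       (auto intro!: ennreal_leI mult_left_mono divide_right_mono power_mono sum_nonneg)
qed

text \<open>
  The right-hand side of the Sobolev inequality for one block at scale \<open>N = 2\<^sup>j\<close>. An integral, unlike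
  a supremum over \<open>t\<close>, commutes with expectation.
\<close>

definition block_energy ::
  "nat \<Rightarrow> (nat \<Rightarrow> real) \<Rightarrow> real \<Rightarrow> (nat \<Rightarrow> real) \<Rightarrow> nat \<Rightarrow> ennreal" where
  "block_energy m a \<theta> z j = (\<integral>\<^sup>+t\<in>{0..1}. ennreal (trig_block a \<theta> z j t ^ (2 * m)
     + (trig_block (freq_mult a) (\<theta> + pi / 2) z j t / 2 ^ j) ^ (2 * m)) \<partial>lborel)"

lemma trig_block_power_le_energy:
  assumes t: "t \<in> {0..1}"
  shows "ennreal (trig_block a \<theta> z j t ^ (2 * m)) \<le> ennreal (real (2 * m + 1) * 2 ^ j) * block_energy m a \<theta> z j"
proof -
  define h where "h s = trig_block a \<theta> z j s ^ (2 * m)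
     + (trig_block (freq_mult a) (\<theta> + pi / 2) z j s / 2 ^ j) ^ (2 * m)" for s
  have "h integrable_on {0..1}"
    unfolding h_def
    by (intro integrable_continuous_real continuous_intros continuous_on_trig_block) auto
  then have int: "(h has_integral integral {0..1} h) {0..1}" by (rule integrable_integral)
  have en: "block_energy m a \<theta> z j = ennreal (integral {0..1} h)"
    unfolding block_energy_def h_def[symmetric]
    by (rule nn_integral_has_integral_lebesgue'[OF _ int]) (simp add: h_def)
  have "trig_block a \<theta> z j t ^ (2 * m) \<le> real (2 * m + 1) * 2 ^ j * integral {0..1} h"
    unfolding h_def
    by (rule even_power_sup_le_integral[OF has_real_derivative_trig_block continuous_on_trig_block _ t]) simp
  then show ?thesis
    unfolding en by (subst ennreal_mult'[symmetric]) (auto intro: ennreal_leI)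
qed

lemma measurable_block_energy [measurable]:
  assumes [measurable]: "\<And>k. Y k \<in> borel_measurable M"
  shows "(\<lambda>\<omega>. block_energy m a \<theta> (\<lambda>k. Y k \<omega>) j) \<in> borel_measurable M"
  unfolding block_energy_def by measurable

text \<open>
  By Tonelli it suffices to bound the moments at each fixed \<open>t\<close>. On the block \<open>k < 2 N\<close>, so the
  coefficients \<open>2 \<pi> k a\<^sub>k / N\<close> of the rescaled derivative are at most \<open>4 \<pi> \<bar>a\<^sub>k\<bar>\<close>.
\<close>

lemma expected_block_energy_le:
  assumes "prob_space M" and Y: "iid_std_gaussian_seq M Y"
  shows "(\<integral>\<^sup>+\<omega>. block_energy m a \<theta> (\<lambda>k. Y k \<omega>) j \<partial>M)
    \<le> ennreal (fact (2 * m) / (2 ^ m * fact m) * (1 + (4 * pi) ^ (2 * m)) * (\<Sum>k\<in>{2^j..<2^Suc j}. (a k)\<^sup>2) ^ m)"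
proof -
  interpret prob_space M by fact
  interpret pair_sigma_finite lborel M
    by (intro pair_sigma_finite.intro sigma_finite_lborel sigma_finite_measure_axioms)
  note [measurable] = iid_std_gaussian_seq_measurable[OF Y]
  define C :: real where "C = fact (2 * m) / (2 ^ m * fact m)"
  define V where "V = (\<Sum>k\<in>{2^j..<2^Suc j}. (a k)\<^sup>2)"
  have C: "0 \<le> C" and V: "0 \<le> V" by (auto simp: C_def V_def intro: sum_nonneg)
  let ?F = "\<lambda>t \<omega>. trig_block a \<theta> (\<lambda>k. Y k \<omega>) j t"
  let ?G = "\<lambda>t \<omega>. trig_block (freq_mult a) (\<theta> + pi / 2) (\<lambda>k. Y k \<omega>) j t / 2 ^ j"
  have F: "(\<integral>\<^sup>+\<omega>. ennreal (?F t \<omega> ^ (2 * m)) \<partial>M) \<le> ennreal (C * V ^ m)" for t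
    unfolding C_def V_def by (rule trig_block_moment_le) fact+
  have "(\<Sum>k\<in>{2^j..<2^Suc j}. (freq_mult a k / 2 ^ j)\<^sup>2)
      \<le> (\<Sum>k\<in>{2^j..<2^Suc j}. (4 * pi)\<^sup>2 * (a k)\<^sup>2)"
  proof (rule sum_mono)
    fix k :: nat assume k: "k \<in> {2^j..<2^Suc j}"
    then have "real k \<le> 2 * 2 ^ j"
      by (metis atLeastLessThan_iff less_imp_le of_nat_le_iff of_nat_numeral of_nat_power power_Suc of_nat_mult)
    then have "2 * pi * (real k / 2 ^ j) \<le> 2 * pi * 2"
      by (intro mult_left_mono) (auto simp: field_simps)
    then have "(2 * pi * (real k / 2 ^ j))\<^sup>2 \<le> (4 * pi)\<^sup>2"
      by (intro power_mono) auto
    then have "(2 * pi * (real k / 2 ^ j))\<^sup>2 * (a k)\<^sup>2 \<le> (4 * pi)\<^sup>2 * (a k)\<^sup>2"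
      by (rule mult_right_mono) simp
    then show "(freq_mult a k / 2 ^ j)\<^sup>2 \<le> (4 * pi)\<^sup>2 * (a k)\<^sup>2"
      by (simp add: freq_mult_def power_mult_distrib power_divide)
  qed
  also have "\<dots> = (4 * pi)\<^sup>2 * V" by (simp add: V_def sum_distrib_left)
  finally have "(\<Sum>k\<in>{2^j..<2^Suc j}. (freq_mult a k / 2 ^ j)\<^sup>2) ^ m \<le> ((4 * pi)\<^sup>2 * V) ^ m"
    by (intro power_mono sum_nonneg) auto
  also have "\<dots> = (4 * pi) ^ (2 * m) * V ^ m" by (simp add: power_mult_distrib power_mult)
  finally have "(\<Sum>k\<in>{2^j..<2^Suc j}. (freq_mult a k / 2 ^ j)\<^sup>2) ^ m \<le> (4 * pi) ^ (2 * m) * V ^ m" .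
  from ennreal_leI[OF mult_left_mono[OF this C]]
  have G: "(\<integral>\<^sup>+\<omega>. ennreal (?G t \<omega> ^ (2 * m)) \<partial>M) \<le> ennreal (C * ((4 * pi) ^ (2 * m) * V ^ m))" for t
    unfolding trig_block_divide
    by (rule order.trans[OF trig_block_moment_le[OF \<open>prob_space M\<close> Y, where m = m, folded C_def]])
  have FG: "(\<integral>\<^sup>+\<omega>. ennreal (?F t \<omega> ^ (2 * m)) \<partial>M) + (\<integral>\<^sup>+\<omega>. ennreal (?G t \<omega> ^ (2 * m)) \<partial>M)
      \<le> ennreal (C * (1 + (4 * pi) ^ (2 * m)) * V ^ m)" for t
  proof -
    have "ennreal (C * V ^ m) + ennreal (C * ((4 * pi) ^ (2 * m) * V ^ m))
        = ennreal (C * (1 + (4 * pi) ^ (2 * m)) * V ^ m)"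
      by (subst ennreal_plus[symmetric]) (use C V in \<open>auto simp: algebra_simps\<close>)
    then show ?thesis using add_mono[OF F[of t] G[of t]] by simp
  qed
  have "(\<integral>\<^sup>+\<omega>. block_energy m a \<theta> (\<lambda>k. Y k \<omega>) j \<partial>M)
      = (\<integral>\<^sup>+t. (\<integral>\<^sup>+\<omega>. ennreal (?F t \<omega> ^ (2 * m) + ?G t \<omega> ^ (2 * m)) * indicator {0..1} t \<partial>M) \<partial>lborel)"
    unfolding block_energy_def by (rule Fubini') measurable
  also have "\<dots> = (\<integral>\<^sup>+t. ((\<integral>\<^sup>+\<omega>. ennreal (?F t \<omega> ^ (2 * m)) \<partial>M) + (\<integral>\<^sup>+\<omega>. ennreal (?G t \<omega> ^ (2 * m)) \<partial>M))
      * indicator {0..1} t \<partial>lborel)"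
    by (subst nn_integral_multc) (auto simp: nn_integral_add)
  also have "\<dots> \<le> (\<integral>\<^sup>+t. ennreal (C * (1 + (4 * pi) ^ (2 * m)) * V ^ m) * indicator {0..1::real} t \<partial>lborel)"
    by (intro nn_integral_mono mult_right_mono FG) auto
  also have "\<dots> = ennreal (C * (1 + (4 * pi) ^ (2 * m)) * V ^ m)"
    by (subst nn_integral_cmult_indicator) auto
  finally show ?thesis unfolding C_def V_def .
qed

section \<open>Almost sure decay of the blocks\<close>

text \<open>
  The block has \<open>2\<^sup>j\<close> terms, on which \<open>k powr - r\<close> is comparable to \<open>2 powr (- r j)\<close>. The
  constant \<open>2 powr \<bar>r\<bar>\<close> serves both signs of \<open>r\<close>: the second derivative of the series leads to a
  negative exponent of decay.
\<close>

lemma dyadic_block_sum_le: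
  assumes a: "\<And>k. 1 \<le> k \<Longrightarrow> (a k)\<^sup>2 \<le> B * real k powr - r"
  shows "(\<Sum>k\<in>{2^j..<2^Suc j}. (a k)\<^sup>2) \<le> B * 2 powr \<bar>r\<bar> * 2 powr ((1 - r) * real j)"
proof -
  have B: "0 \<le> B" using order_trans[OF zero_le_power2 a[of 1]] by simp
  have "(a k)\<^sup>2 \<le> B * (2 powr \<bar>r\<bar> * 2 powr (- r * j))" if k: "k \<in> {2^j..<2^Suc j}" for k
  proof -
    have k1: "1 \<le> k" using k by (metis atLeastLessThan_iff one_le_numeral one_le_power order_trans)
    define q where "q = real k / 2 ^ j"
    have k': "real (2 ^ j) \<le> real k" "real k < real (2 ^ Suc j)"
      using k by (auto simp only: of_nat_le_iff of_nat_less_iff atLeastLessThan_iff)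
    then have q: "1 \<le> q" "q \<le> 2"
      by (auto simp: q_def field_simps)
    have "real k powr - r = (q * 2 powr j) powr - r"
      by (simp add: q_def powr_realpow)
    also have "\<dots> = q powr - r * 2 powr (- r * j)"
      using q by (simp add: powr_mult powr_powr mult.commute)
    also have "q powr - r \<le> q powr \<bar>r\<bar>" using q by (intro powr_mono) auto
    also have "q powr \<bar>r\<bar> \<le> 2 powr \<bar>r\<bar>" using q by (intro powr_mono2) auto
    finally have "real k powr - r \<le> 2 powr \<bar>r\<bar> * 2 powr (- r * j)" by simp
    then show ?thesis using a[OF k1] B by (meson mult_left_mono order_trans)
  qed
  then have "(\<Sum>k\<in>{2^j..<2^Suc j}. (a k)\<^sup>2) \<le> real (card {2^j..<2^Suc j::nat}) * (B * (2 powr \<bar>r\<bar> * 2 powr (- r * j)))"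
    by (rule sum_bounded_above)
  also have "\<dots> = B * 2 powr \<bar>r\<bar> * (2 powr j * 2 powr (- r * j))"
    by (simp add: powr_realpow)
  also have "2 powr j * 2 powr (- r * j) = 2 powr ((1 - r) * real j)"
    by (simp add: powr_add[symmetric] algebra_simps)
  finally show ?thesis .
qed

text \<open>
  Weighting the bound on the \<open>2m\<close>-th power of the supremum by \<open>2 powr (2m \<gamma> j)\<close> gives
  expectations of order \<open>2 powr (j (1 - m \<delta>))\<close> with \<open>\<delta> = r - 1 - 2\<gamma> > 0\<close>, which are summable
  once \<open>m \<delta> > 1\<close>. A random series with finite expectation is finite almost surely, and then
  dominates each of its terms.
\<close>

lemma AE_trig_block_decay:
  assumes M: "prob_space M" and Y: "iid_std_gaussian_seq M Y"
    and a: "\<And>k. 1 \<le> k \<Longrightarrow> (a k)\<^sup>2 \<le> B * real k powr - r"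
    and \<gamma>: "\<gamma> < (r - 1) / 2"
  shows "AE \<omega> in M. \<exists>K. \<forall>j. \<forall>t\<in>{0..1}. \<bar>trig_block a \<theta> (\<lambda>k. Y k \<omega>) j t\<bar> \<le> K * 2 powr (- \<gamma> * real j)"
proof -
  interpret prob_space M by fact
  note [measurable] = iid_std_gaussian_seq_measurable[OF Y]
  have B: "0 \<le> B" using order_trans[OF zero_le_power2 a[of 1]] by simp
  define \<delta> where "\<delta> = r - 1 - 2 * \<gamma>"
  have \<delta>: "\<delta> > 0" using \<gamma> by (simp add: \<delta>_def)
  \<comment> \<open>The loss of one factor \<open>2\<^sup>j\<close> in the Sobolev inequality is beaten by high moments.\<close>
  obtain m :: nat where "real m > 1 / \<delta>" using reals_Archimedean2 by blast
  then have m: "1 < m * \<delta>" using \<delta> by (simp add: field_simps)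
  then have "m > 0" by (cases m) auto
  define e where "e = 1 - m * \<delta>"
  define D where "D = fact (2 * m) / (2 ^ m * fact m) * (1 + (4 * pi) ^ (2 * m))"
  define B' where "B' = B * 2 powr \<bar>r\<bar>"
  have D: "0 \<le> D" and B': "0 \<le> B'" using B by (auto simp: D_def B'_def)
  define w where "w j = 2 powr (2 * m * \<gamma> * real j) * (real (2 * m + 1) * 2 ^ j)" for j :: nat
  have w0: "0 \<le> w j" for j by (simp add: w_def)
  define E where "E \<omega> = (\<Sum>j. ennreal (w j) * block_energy m a \<theta> (\<lambda>k. Y k \<omega>) j)" for \<omega>
  have "(\<integral>\<^sup>+\<omega>. E \<omega> \<partial>M) = (\<Sum>j. ennreal (w j) * (\<integral>\<^sup>+\<omega>. block_energy m a \<theta> (\<lambda>k. Y k \<omega>) j \<partial>M))"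
    unfolding E_def by (subst nn_integral_suminf) (auto simp: nn_integral_cmult)
  also have "\<dots> \<le> (\<Sum>j. ennreal ((2 * m + 1) * D * B' ^ m * (2 powr e) ^ j))"
  proof (intro suminf_le)
    fix j
    have "(\<integral>\<^sup>+\<omega>. block_energy m a \<theta> (\<lambda>k. Y k \<omega>) j \<partial>M) \<le> ennreal (D * (B' * 2 powr ((1 - r) * real j)) ^ m)"
      using dyadic_block_sum_le[OF a, where j = j, folded B'_def] D
      by (intro order.trans[OF expected_block_energy_le[OF M Y, where m = m, folded D_def] ennreal_leI]
            mult_left_mono power_mono sum_nonneg) auto
    then have "ennreal (w j) * (\<integral>\<^sup>+\<omega>. block_energy m a \<theta> (\<lambda>k. Y k \<omega>) j \<partial>M)
        \<le> ennreal (w j) * ennreal (D * (B' * 2 powr ((1 - r) * real j)) ^ m)"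
      by (rule mult_left_mono) simp
    also have "\<dots> = ennreal (w j * (D * (B' * 2 powr ((1 - r) * real j)) ^ m))"
      by (rule ennreal_mult'[symmetric]) (rule w0)
    also have "w j * (D * (B' * 2 powr ((1 - r) * real j)) ^ m)
        = (2 * m + 1) * D * B' ^ m * (2 powr (2 * m * \<gamma> * real j) * 2 powr j * 2 powr ((1 - r) * real j * m))"
      by (simp add: w_def power_mult_distrib powr_realpow powr_powr[symmetric])
    also have "2 powr (2 * m * \<gamma> * real j) * 2 powr j * 2 powr ((1 - r) * real j * m) = 2 powr (e * j)"
      by (simp add: powr_add[symmetric] e_def \<delta>_def algebra_simps)
    also have "\<dots> = (2 powr e) ^ j" by (simp add: powr_realpow[symmetric] powr_powr)
    finally show "ennreal (w j) * (\<integral>\<^sup>+\<omega>. block_energy m a \<theta> (\<lambda>k. Y k \<omega>) j \<partial>M)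
      \<le> ennreal ((2 * m + 1) * D * B' ^ m * (2 powr e) ^ j)" .
  qed auto
  also have "\<dots> < \<infinity>"
  proof -
    have "2 powr e < 2 powr 0" using m by (intro powr_less_mono) (auto simp: e_def)
    then have "summable (\<lambda>j. (2 * m + 1) * D * B' ^ m * (2 powr e) ^ j)"
      by (intro summable_mult summable_geometric) simp
    then show ?thesis
      using D B' by (simp add: ennreal_suminf_neq_top less_top[symmetric])
  qed
  finally have "AE \<omega> in M. E \<omega> \<noteq> \<infinity>"
    by (intro nn_integral_PInf_AE) (auto simp: E_def)
  then show ?thesis
  proof eventually_elim
    case (elim \<omega>)
    define L where "L = enn2real (E \<omega>)"
    have L: "E \<omega> = ennreal L" "0 \<le> L" using elim by (auto simp: L_def less_top[symmetric])
    have "\<bar>trig_block a \<theta> (\<lambda>k. Y k \<omega>) j t\<bar> \<le> (1 + L) * 2 powr (- \<gamma> * real j)" if t: "t \<in> {0..1}" for j t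
    proof -
      define u where "u = 2 powr (\<gamma> * real j) * \<bar>trig_block a \<theta> (\<lambda>k. Y k \<omega>) j t\<bar>"
      have u0: "0 \<le> u" by (simp add: u_def)
      have pow: "2 powr (2 * m * \<gamma> * real j) = (2 powr (\<gamma> * real j)) ^ (2 * m)"
        by (simp add: powr_powr powr_realpow[symmetric] mult_ac)
      have "ennreal (u ^ (2 * m)) = ennreal (2 powr (2 * m * \<gamma> * real j)) * ennreal (trig_block a \<theta> (\<lambda>k. Y k \<omega>) j t ^ (2 * m))"
        unfolding pow by (subst ennreal_mult'[symmetric]) (simp_all add: u_def power_mult_distrib power_even_abs)
      also have "\<dots> \<le> ennreal (2 powr (2 * m * \<gamma> * real j)) * (ennreal (real (2 * m + 1) * 2 ^ j) * block_energy m a \<theta> (\<lambda>k. Y k \<omega>) j)"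
        by (intro mult_left_mono trig_block_power_le_energy t) simp
      also have "\<dots> = ennreal (w j) * block_energy m a \<theta> (\<lambda>k. Y k \<omega>) j"
        unfolding w_def by (subst ennreal_mult'') (auto simp: mult.assoc)
      also have "\<dots> \<le> E \<omega>"
        unfolding E_def using sum_le_suminf[of "\<lambda>j. ennreal (w j) * block_energy m a \<theta> (\<lambda>k. Y k \<omega>) j" "{j}"] by simp
      finally have "u ^ (2 * m) \<le> L" unfolding L(1) using L(2) by simp
      \<comment> \<open>As \<open>u\<close> is at most the maximum of \<open>1\<close> and \<open>u\<^sup>2\<^sup>m\<close>, a bound on the power passes to \<open>u\<close> without taking a root.\<close>
      moreover have "u \<le> 1 \<or> u \<le> u ^ (2 * m)"
        using self_le_power[of u "2 * m"] \<open>m > 0\<close> by linarith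
      ultimately have "u \<le> 1 + L" using L(2) by linarith
      then show ?thesis by (simp add: u_def powr_minus field_simps)
    qed
    then show ?case by blast
  qed
qed

section \<open>Regularity of sums over dyadic scales\<close>

lemma summable_dyadic_powr:
  fixes K \<gamma> :: real
  assumes "0 < \<gamma>"
  shows "summable (\<lambda>j. K * 2 powr (- \<gamma> * real j))"
proof -
  have "2 powr - \<gamma> < (1::real)" using assms powr_less_mono[of "- \<gamma>" 0 2] by auto
  then have "summable (\<lambda>j. K * (2 powr - \<gamma>) ^ j)"
    by (intro summable_mult summable_geometric) simp
  then show ?thesis by (simp add: powr_realpow[symmetric] powr_powr)
qed

lemma powr_interpolation_le:
  fixes u a b \<beta> :: real
  assumes "0 \<le> u" "u \<le> a" "u \<le> b" "0 \<le> \<beta>" "\<beta> \<le> 1"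
  shows "u \<le> a powr (1 - \<beta>) * b powr \<beta>"
proof -
  have "u = u powr (1 - \<beta>) * u powr \<beta>" using assms by (simp add: powr_add[symmetric])
  also have "\<dots> \<le> a powr (1 - \<beta>) * b powr \<beta>"
    using assms by (intro mult_mono powr_mono2) auto
  finally show ?thesis .
qed

text \<open>
  The increment of \<open>g j\<close> between \<open>s\<close> and \<open>t\<close> is at most \<open>2 K 2 powr (- \<gamma> j)\<close>, and by the
  mean value theorem at most \<open>K 2 powr ((1 - \<gamma>) j) \<bar>s - t\<bar>\<close>. The geometric mean of the two bounds with
  weights \<open>1 - \<beta>\<close> and \<open>\<beta>\<close> is \<open>2 K 2 powr ((\<beta> - \<gamma>) j) \<bar>s - t\<bar> powr \<beta>\<close>, which is summable
  over \<open>j\<close> as \<open>\<beta> < \<gamma>\<close>.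
\<close>

lemma holder_on_suminf_dyadic:
  fixes g h :: "nat \<Rightarrow> real \<Rightarrow> real"
  assumes S: "convex S"
    and deriv: "\<And>j s. s \<in> S \<Longrightarrow> (g j has_real_derivative h j s) (at s within S)"
    and g: "\<And>j s. s \<in> S \<Longrightarrow> \<bar>g j s\<bar> \<le> K * 2 powr (- \<gamma> * real j)"
    and h: "\<And>j s. s \<in> S \<Longrightarrow> \<bar>h j s\<bar> \<le> K * 2 powr ((1 - \<gamma>) * real j)"
    and \<beta>: "0 < \<beta>" "\<beta> < \<gamma>" "\<beta> \<le> 1"
  shows "holder_on \<beta> S (\<lambda>s. \<Sum>j. g j s)"
proof (cases "S = {}")
  case True
  then show ?thesis by (simp add: holder_on_def)
next
  case False
  have "0 \<le> K"
    using False g[of _ 0] by fastforce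
  define \<rho> :: real where "\<rho> = 2 powr (\<beta> - \<gamma>)"
  have \<rho>: "0 < \<rho>" "\<rho> < 1" using \<beta> powr_less_mono[of "\<beta> - \<gamma>" 0 2] by (auto simp: \<rho>_def)
  have "0 < \<gamma>" using \<beta> by simp
  have sum_g: "summable (\<lambda>j. g j s)" if "s \<in> S" for s
    by (rule summable_comparison_test'[OF summable_dyadic_powr[OF \<open>0 < \<gamma>\<close>, of K], of 0]) (use g[OF that] in auto)
  have increment: "\<bar>g j s - g j t\<bar> \<le> 2 * K * \<bar>s - t\<bar> powr \<beta> * \<rho> ^ j" if st: "s \<in> S" "t \<in> S" for j s t
  proof -
    have "\<bar>g j s - g j t\<bar> \<le> \<bar>g j s\<bar> + \<bar>g j t\<bar>" by simp
    also have "\<dots> \<le> 2 * K * 2 powr (- \<gamma> * real j)"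
      using g[OF st(1), of j] g[OF st(2), of j] by simp
    finally have 1: "\<bar>g j s - g j t\<bar> \<le> 2 * K * 2 powr (- \<gamma> * real j)" .
    have "\<bar>g j s - g j t\<bar> \<le> K * 2 powr ((1 - \<gamma>) * real j) * \<bar>s - t\<bar>"
      using field_differentiable_bound[OF S deriv _ st, of j "K * 2 powr ((1 - \<gamma>) * real j)"] h by simp
    \<comment> \<open>The factor \<open>2\<close> gives both bounds the same constant \<open>2 K\<close>.\<close>
    also have "\<dots> \<le> 2 * (K * 2 powr ((1 - \<gamma>) * real j) * \<bar>s - t\<bar>)" using \<open>0 \<le> K\<close> by simp
    finally have 2: "\<bar>g j s - g j t\<bar> \<le> 2 * K * 2 powr ((1 - \<gamma>) * real j) * \<bar>s - t\<bar>" by simp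
    have "\<bar>g j s - g j t\<bar> \<le> (2 * K * 2 powr (- \<gamma> * real j)) powr (1 - \<beta>)
        * (2 * K * 2 powr ((1 - \<gamma>) * real j) * \<bar>s - t\<bar>) powr \<beta>"
      by (rule powr_interpolation_le[OF _ 1 2]) (use \<beta> in auto)
    also have "\<dots> = ((2 * K) powr (1 - \<beta>) * (2 * K) powr \<beta>) * \<bar>s - t\<bar> powr \<beta> *
        (2 powr (- \<gamma> * real j * (1 - \<beta>)) * 2 powr ((1 - \<gamma>) * real j * \<beta>))"
      using \<open>0 \<le> K\<close> by (simp add: powr_mult powr_powr)
    also have "(2 * K) powr (1 - \<beta>) * (2 * K) powr \<beta> = 2 * K"
      using \<open>0 \<le> K\<close> by (simp add: powr_add[symmetric])
    also have "2 powr (- \<gamma> * real j * (1 - \<beta>)) * 2 powr ((1 - \<gamma>) * real j * \<beta>) = \<rho> ^ j"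
      by (simp add: powr_add[symmetric] \<rho>_def powr_realpow[symmetric] powr_powr algebra_simps)
    finally show ?thesis .
  qed
  have "\<bar>(\<Sum>j. g j s) - (\<Sum>j. g j t)\<bar> \<le> (2 * K * (1 / (1 - \<rho>))) * \<bar>s - t\<bar> powr \<beta>" if st: "s \<in> S" "t \<in> S" for s t
  proof -
    have "(\<Sum>j. g j s) - (\<Sum>j. g j t) = (\<Sum>j. g j s - g j t)"
      by (rule suminf_diff[OF sum_g[OF st(1)] sum_g[OF st(2)]])
    moreover have "norm (\<Sum>j. g j s - g j t) \<le> (\<Sum>j. 2 * K * \<bar>s - t\<bar> powr \<beta> * \<rho> ^ j)"
      by (rule norm_suminf_le) (use increment[OF st] \<rho> in \<open>auto intro!: summable_mult summable_geometric\<close>)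
    moreover have "(\<Sum>j. 2 * K * \<bar>s - t\<bar> powr \<beta> * \<rho> ^ j) = 2 * K * \<bar>s - t\<bar> powr \<beta> * (1 / (1 - \<rho>))"
      using \<rho> by (simp add: suminf_mult summable_geometric suminf_geometric)
    ultimately show ?thesis by (simp add: mult_ac)
  qed
  then show ?thesis unfolding holder_on_def by blast
qed

lemma holder_on_add:
  assumes "holder_on \<beta> S f" "holder_on \<beta> S g"
  shows "holder_on \<beta> S (\<lambda>s. f s + g s)"
proof -
  obtain K L where K: "\<And>s t. s \<in> S \<Longrightarrow> t \<in> S \<Longrightarrow> \<bar>f s - f t\<bar> \<le> K * \<bar>s - t\<bar> powr \<beta>"
    and L: "\<And>s t. s \<in> S \<Longrightarrow> t \<in> S \<Longrightarrow> \<bar>g s - g t\<bar> \<le> L * \<bar>s - t\<bar> powr \<beta>"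
    using assms unfolding holder_on_def by blast
  have "\<bar>f s + g s - (f t + g t)\<bar> \<le> (K + L) * \<bar>s - t\<bar> powr \<beta>" if "s \<in> S" "t \<in> S" for s t
    using K[OF that] L[OF that] by (simp add: distrib_right)
  then show ?thesis unfolding holder_on_def by blast
qed

lemma holder_on_imp_continuous_on:
  assumes "holder_on \<beta> S f" "0 < \<beta>"
  shows "continuous_on S f"
proof -
  obtain K where K: "\<And>s t. s \<in> S \<Longrightarrow> t \<in> S \<Longrightarrow> \<bar>f s - f t\<bar> \<le> K * \<bar>s - t\<bar> powr \<beta>"
    using assms unfolding holder_on_def by blast
  show ?thesis
    unfolding continuous_on_def
  proof
    fix t assume t: "t \<in> S"
    have "((\<lambda>s. K * \<bar>s - t\<bar> powr \<beta>) \<longlongrightarrow> K * \<bar>t - t\<bar> powr \<beta>) (at t within S)"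
      using \<open>0 < \<beta>\<close> by (intro tendsto_intros) (auto intro!: always_eventually)
    then have lim: "((\<lambda>s. K * \<bar>s - t\<bar> powr \<beta>) \<longlongrightarrow> 0) (at t within S)" by simp
    have "((\<lambda>s. f s - f t) \<longlongrightarrow> 0) (at t within S)"
      by (rule Lim_null_comparison[OF _ lim]) (auto simp: eventually_at_filter K t intro!: always_eventually)
    then show "(f \<longlongrightarrow> f t) (at t within S)" by (simp add: LIM_zero_iff)
  qed
qed

lemma C1_imp_lipschitz_on:
  fixes f f' :: "real \<Rightarrow> real"
  assumes deriv: "\<And>t. t \<in> S \<Longrightarrow> (f has_real_derivative f' t) (at t within S)"
    and cont: "continuous_on S f'" and S: "convex S" "compact S"
  shows "\<exists>L. L-lipschitz_on S f"
proof -
  have "bounded (f' ` S)" using compact_continuous_image[OF cont] S by (simp add: compact_imp_bounded)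
  then obtain L where L: "L > 0" "\<And>t. t \<in> S \<Longrightarrow> norm (f' t) \<le> L" by (auto simp: bounded_pos)
  have "L-lipschitz_on S f"
    using field_differentiable_bound[OF S(1) deriv L(2)] L(1)
    by (intro lipschitz_onI) (auto simp: dist_norm)
  then show ?thesis ..
qed

section \<open>A random Fourier series driven by one Gaussian sequence\<close>

text \<open>
  Each differentiation lowers the decay exponent of the squared coefficients by \<open>2\<close>, so the
  admissible rate \<open>\<gamma>\<close> for the blocks drops from below \<open>1 + \<alpha> / 2\<close> to below \<open>\<alpha> / 2\<close> and then
  below \<open>\<alpha> / 2 - 1\<close>. The first two rates give termwise differentiation, the last two are the hypotheses of
  \<open>holder_on_suminf_dyadic\<close>.
\<close>

lemma AE_trig_block_series_C1_holder:
  fixes \<theta> :: real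
  assumes M: "prob_space M" and Y: "iid_std_gaussian_seq M Y"
    and a: "\<forall>k\<ge>1. (a k)\<^sup>2 \<le> B * real k powr - (3 + \<alpha>)" and \<alpha>: "0 < \<alpha>" "\<alpha> \<le> 2"
  defines "F \<equiv> \<lambda>\<omega>. trig_block a \<theta> (\<lambda>k. Y k \<omega>)"
    and "F' \<equiv> \<lambda>\<omega>. trig_block (freq_mult a) (\<theta> + pi / 2) (\<lambda>k. Y k \<omega>)"
  shows "AE \<omega> in M. \<forall>t\<in>{0..1}. summable (\<lambda>j. F \<omega> j t) \<and>
      ((\<lambda>s. \<Sum>j. F \<omega> j s) has_real_derivative (\<Sum>j. F' \<omega> j t)) (at t within {0..1})"
    and "AE \<omega> in M. \<forall>\<beta>. 0 < \<beta> \<and> \<beta> < \<alpha> / 2 \<longrightarrow> holder_on \<beta> {0..1} (\<lambda>t. \<Sum>j. F' \<omega> j t)"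
proof -
  define F'' where "F'' \<omega> = trig_block (freq_mult (freq_mult a)) (\<theta> + pi / 2 + pi / 2) (\<lambda>k. Y k \<omega>)" for \<omega>
  have freq: "(freq_mult b k)\<^sup>2 \<le> (2 * pi)\<^sup>2 * C * real k powr - (r - 2)"
    if b: "(b k)\<^sup>2 \<le> C * real k powr - r" and k: "1 \<le> k" for b C r k
  proof -
    have "(freq_mult b k)\<^sup>2 = (2 * pi)\<^sup>2 * (real k powr 2 * (b k)\<^sup>2)"
      using k by (simp add: freq_mult_def power_mult_distrib)
    also have "\<dots> \<le> (2 * pi)\<^sup>2 * (real k powr 2 * (C * real k powr - r))"
      using b by (intro mult_left_mono) auto
    also have "\<dots> = (2 * pi)\<^sup>2 * C * (real k powr 2 * real k powr - r)" by simp
    also have "real k powr 2 * real k powr - r = real k powr - (r - 2)"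
      using powr_add[of "real k" 2 "- r"] by simp
    finally show ?thesis .
  qed
  have a': "(freq_mult a k)\<^sup>2 \<le> (2 * pi)\<^sup>2 * B * real k powr - (1 + \<alpha>)" if "1 \<le> k" for k
    using freq[where b = a and r = "3 + \<alpha>", OF a[rule_format, OF that] that] by simp
  have a'': "(freq_mult (freq_mult a) k)\<^sup>2 \<le> (2 * pi)\<^sup>2 * ((2 * pi)\<^sup>2 * B) * real k powr - (\<alpha> - 1)" if "1 \<le> k" for k
    using freq[where b = "freq_mult a" and r = "1 + \<alpha>", OF a'[OF that] that] by simp
  have dF: "(F \<omega> j has_real_derivative F' \<omega> j t) (at t within S)" for \<omega> j t S
    unfolding F_def F'_def by (rule has_real_derivative_trig_block)
  have dF': "(F' \<omega> j has_real_derivative F'' \<omega> j t) (at t within S)" for \<omega> j t S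
    unfolding F'_def F''_def by (rule has_real_derivative_trig_block)
  have bound0: "AE \<omega> in M. \<exists>K. \<forall>j. \<forall>t\<in>{0..1}. \<bar>F \<omega> j t\<bar> \<le> K * 2 powr (- 1 * real j)"
    unfolding F_def by (rule AE_trig_block_decay[OF M Y a[rule_format]]) (use \<alpha> in auto)
  have bound1: "AE \<omega> in M. \<exists>K. \<forall>j. \<forall>t\<in>{0..1}. \<bar>F' \<omega> j t\<bar> \<le> K * 2 powr (- \<gamma> * real j)" if "\<gamma> < \<alpha> / 2" for \<gamma>
    unfolding F'_def by (rule AE_trig_block_decay[OF M Y a']) (use that in auto)
  have bound2: "AE \<omega> in M. \<exists>K. \<forall>j. \<forall>t\<in>{0..1}. \<bar>F'' \<omega> j t\<bar> \<le> K * 2 powr ((1 - \<gamma>) * real j)" if "\<gamma> < \<alpha> / 2" for \<gamma>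
    using AE_trig_block_decay[OF M Y a'', where \<gamma> = "\<gamma> - 1" and \<theta> = "\<theta> + pi / 2 + pi / 2", folded F''_def] that
    by simp
  have "\<alpha> / 4 < \<alpha> / 2" using \<alpha> by simp
  from bound0 bound1[OF this]
  show "AE \<omega> in M. \<forall>t\<in>{0..1}. summable (\<lambda>j. F \<omega> j t) \<and>
      ((\<lambda>s. \<Sum>j. F \<omega> j s) has_real_derivative (\<Sum>j. F' \<omega> j t)) (at t within {0..1})"
  proof eventually_elim
    case (elim \<omega>)
    then obtain K L where K: "\<And>j t. t \<in> {0..1} \<Longrightarrow> \<bar>F \<omega> j t\<bar> \<le> K * 2 powr (- 1 * real j)"
      and L: "\<And>j t. t \<in> {0..1} \<Longrightarrow> \<bar>F' \<omega> j t\<bar> \<le> L * 2 powr (- (\<alpha> / 4) * real j)" by blast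
    have "uniform_limit {0..1} (\<lambda>n t. \<Sum>j<n. F' \<omega> j t) (\<lambda>t. \<Sum>j. F' \<omega> j t) sequentially"
      by (rule Weierstrass_m_test[OF _ summable_dyadic_powr[of "\<alpha> / 4" L]]) (use L \<alpha> in auto)
    moreover have "summable (\<lambda>j. F \<omega> j 0)"
      by (rule summable_comparison_test'[OF summable_dyadic_powr[of 1 K], of 0]) (use K in auto)
    ultimately have "\<exists>G. \<forall>t\<in>{0..1}. (\<lambda>j. F \<omega> j t) sums G t
        \<and> (G has_real_derivative (\<Sum>j. F' \<omega> j t)) (at t within {0..1})"
      by (intro has_field_derivative_series[of _ _ _ _ 0]) (auto intro: dF)
    then obtain G where G: "\<And>t. t \<in> {0..1} \<Longrightarrow> (\<lambda>j. F \<omega> j t) sums G t"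
      "\<And>t. t \<in> {0..1} \<Longrightarrow> (G has_real_derivative (\<Sum>j. F' \<omega> j t)) (at t within {0..1})"
      by blast
    show ?case
    proof (intro ballI conjI)
      fix t :: real assume t: "t \<in> {0..1}"
      show "summable (\<lambda>j. F \<omega> j t)" using G(1)[OF t] by (rule sums_summable)
      show "((\<lambda>s. \<Sum>j. F \<omega> j s) has_real_derivative (\<Sum>j. F' \<omega> j t)) (at t within {0..1})"
        by (rule has_field_derivative_transform_within[OF G(2)[OF t] zero_less_one t])
          (use G(1) sums_unique in auto)
    qed
  qed
  \<comment> \<open>The exceptional null set must not depend on \<open>\<beta>\<close>: a sequence of rates increasing to \<open>\<alpha> / 2\<close> suffices.\<close>
  define \<gamma> where "\<gamma> n = \<alpha> / 2 - \<alpha> / 2 / real (Suc n)" for n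
  have \<gamma>: "\<gamma> n < \<alpha> / 2" for n using \<alpha> by (simp add: \<gamma>_def)
  have "AE \<omega> in M. \<forall>n. (\<exists>K. \<forall>j. \<forall>t\<in>{0..1}. \<bar>F' \<omega> j t\<bar> \<le> K * 2 powr (- \<gamma> n * real j)) \<and>
      (\<exists>K. \<forall>j. \<forall>t\<in>{0..1}. \<bar>F'' \<omega> j t\<bar> \<le> K * 2 powr ((1 - \<gamma> n) * real j))"
    using bound1[OF \<gamma>] bound2[OF \<gamma>] by (auto simp: AE_all_countable)
  then show "AE \<omega> in M. \<forall>\<beta>. 0 < \<beta> \<and> \<beta> < \<alpha> / 2 \<longrightarrow> holder_on \<beta> {0..1} (\<lambda>t. \<Sum>j. F' \<omega> j t)"
  proof eventually_elim
    case (elim \<omega>)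
    show ?case
    proof (intro allI impI)
      fix \<beta> :: real assume \<beta>: "0 < \<beta> \<and> \<beta> < \<alpha> / 2"
      have "\<gamma> \<longlonglongrightarrow> \<alpha> / 2 - 0"
        unfolding \<gamma>_def using LIMSEQ_Suc[OF lim_const_over_n[of "\<alpha> / 2"]] by (intro tendsto_diff tendsto_const)
      then have "\<forall>\<^sub>F n in sequentially. \<beta> < \<gamma> n" using \<beta> by (intro order_tendstoD) auto
      then obtain n where n: "\<beta> < \<gamma> n" by (auto simp: eventually_sequentially)
      obtain K L where K: "\<And>j t. t \<in> {0..1} \<Longrightarrow> \<bar>F' \<omega> j t\<bar> \<le> K * 2 powr (- \<gamma> n * real j)"
        and L: "\<And>j t. t \<in> {0..1} \<Longrightarrow> \<bar>F'' \<omega> j t\<bar> \<le> L * 2 powr ((1 - \<gamma> n) * real j)"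
        using elim by blast
      show "holder_on \<beta> {0..1} (\<lambda>t. \<Sum>j. F' \<omega> j t)"
      proof (rule holder_on_suminf_dyadic[OF _ dF'])
        show "\<bar>F' \<omega> j t\<bar> \<le> max K L * 2 powr (- \<gamma> n * real j)" if "t \<in> {0..1}" for j t
          by (rule order.trans[OF K[OF that]]) (simp add: mult_right_mono)
        show "\<bar>F'' \<omega> j t\<bar> \<le> max K L * 2 powr ((1 - \<gamma> n) * real j)" if "t \<in> {0..1}" for j t
          by (rule order.trans[OF L[OF that]]) (simp add: mult_right_mono)
      qed (use \<beta> n \<alpha> in auto)
    qed
  qed
qed

section \<open>Identification with the given process\<close>

lemma sum_dyadic_blocks:
  "(\<Sum>k=1..2 ^ n - 1. f k) = (\<Sum>j<n. \<Sum>k\<in>{2 ^ j..<2 ^ Suc j}. f k)" for f :: "nat \<Rightarrow> 'b::comm_monoid_add"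
proof -
  have "(\<Sum>k\<in>{1..<2 ^ n}. f k) = (\<Sum>j<n. \<Sum>k\<in>{2 ^ j..<2 ^ Suc j}. f k)"
  proof (induction n)
    case (Suc n)
    have "(\<Sum>k\<in>{1..<2 ^ Suc n}. f k) = (\<Sum>k\<in>{1..<2 ^ n}. f k) + (\<Sum>k\<in>{2 ^ n..<2 ^ Suc n}. f k)"
      by (rule sum.atLeastLessThan_concat[symmetric]) auto
    with Suc show ?case by simp
  qed simp
  moreover have "{1..2 ^ n - 1} = {1..<2 ^ n :: nat}" by auto
  ultimately show ?thesis by simp
qed

lemma fourier_partial_sum_dyadic:
  "fourier_partial_sum c Y Y' (2 ^ n - 1) t \<omega> = c 0 * Y' 0 \<omega>
     + (\<Sum>j<n. trig_block (\<lambda>k. sqrt 2 * c k) 0 (\<lambda>k. Y k \<omega>) j t)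
     + (\<Sum>j<n. trig_block (\<lambda>k. sqrt 2 * c k) (pi / 2) (\<lambda>k. Y' k \<omega>) j t)"
  unfolding fourier_partial_sum_def sum_dyadic_blocks trig_block_def
  by (simp add: sum.distrib[symmetric] sin_add algebra_simps)

text \<open>
  Fatou's lemma: the mean square of \<open>X - Z\<close> is at most the limit inferior of those of
  \<open>X - S n\<close>.
\<close>

lemma AE_eq_of_mean_square_limit:
  assumes [measurable]: "X \<in> borel_measurable M" "Z \<in> borel_measurable M"
      "\<And>n. S n \<in> borel_measurable M"
    and ms: "(\<lambda>n. \<integral>\<^sup>+\<omega>. ennreal ((X \<omega> - S n \<omega>)\<^sup>2) \<partial>M) \<longlonglongrightarrow> 0"
    and lim: "AE \<omega> in M. (\<lambda>n. S n \<omega>) \<longlonglongrightarrow> Z \<omega>"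
  shows "AE \<omega> in M. Z \<omega> = X \<omega>"
proof -
  have "(\<integral>\<^sup>+\<omega>. ennreal ((X \<omega> - Z \<omega>)\<^sup>2) \<partial>M) = (\<integral>\<^sup>+\<omega>. liminf (\<lambda>n. ennreal ((X \<omega> - S n \<omega>)\<^sup>2)) \<partial>M)"
  proof (rule nn_integral_cong_AE, use lim in eventually_elim)
    case (elim \<omega>)
    then have "(\<lambda>n. ennreal ((X \<omega> - S n \<omega>)\<^sup>2)) \<longlonglongrightarrow> ennreal ((X \<omega> - Z \<omega>)\<^sup>2)"
      by (intro tendsto_intros)
    then show ?case by (rule lim_imp_Liminf[OF sequentially_bot, symmetric])
  qed
  also have "\<dots> \<le> liminf (\<lambda>n. \<integral>\<^sup>+\<omega>. ennreal ((X \<omega> - S n \<omega>)\<^sup>2) \<partial>M)"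
    by (rule nn_integral_liminf) simp
  also have "\<dots> = 0" using ms by (simp add: lim_imp_Liminf)
  finally have "(\<integral>\<^sup>+\<omega>. ennreal ((X \<omega> - Z \<omega>)\<^sup>2) \<partial>M) = 0" by simp
  then have "AE \<omega> in M. ennreal ((X \<omega> - Z \<omega>)\<^sup>2) = 0"
    by (subst (asm) nn_integral_0_iff_AE) auto
  then show ?thesis by eventually_elim auto
qed

lemma ms_uniform_limit_imp_pointwise:
  assumes "ms_uniform_limit M T S x" "t \<in> T"
  shows "(\<lambda>n. \<integral>\<^sup>+\<omega>. ennreal ((x t \<omega> - S n t \<omega>)\<^sup>2) \<partial>M) \<longlonglongrightarrow> 0"
proof (rule tendsto_sandwich[OF _ _ tendsto_const])
  show "(\<lambda>n. SUP t\<in>T. \<integral>\<^sup>+\<omega>. ennreal ((x t \<omega> - S n t \<omega>)\<^sup>2) \<partial>M) \<longlonglongrightarrow> 0"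
    using assms(1) by (simp add: ms_uniform_limit_def)
qed (use assms(2) in \<open>auto intro!: SUP_upper always_eventually\<close>)

lemma bigo_inverse_powr_imp_bound:
  fixes f :: "nat \<Rightarrow> real"
  assumes "f \<in> O(\<lambda>k. 1 / real k powr r)"
  shows "\<exists>B. \<forall>k\<ge>1. f k \<le> B * real k powr - r"
proof -
  obtain C where "\<forall>\<^sub>F k in sequentially. norm (f k) \<le> C * norm (1 / real k powr r)"
    using landau_o.bigE[OF assms] by blast
  then obtain N where N: "\<And>k. k \<ge> N \<Longrightarrow> norm (f k) \<le> C * norm (1 / real k powr r)"
    by (auto simp: eventually_sequentially)
  define B where "B = \<bar>C\<bar> + (\<Sum>i<N. \<bar>f i\<bar> * real i powr r)"
  have "f k \<le> B * real k powr - r" if k: "k \<ge> 1" for k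
  proof -
    have pos: "real k powr r > 0" using k by simp
    have "f k * real k powr r \<le> B"
    proof (cases "k \<ge> N")
      case True
      have "f k * real k powr r \<le> \<bar>f k\<bar> * real k powr r" by (simp add: mult_right_mono)
      also have "\<dots> \<le> C" using N[OF True] pos by (simp add: field_simps)
      also have "C \<le> B" by (simp add: B_def add_increasing2 sum_nonneg)
      finally show ?thesis .
    next
      case False
      have "f k * real k powr r \<le> \<bar>f k\<bar> * real k powr r" by (simp add: mult_right_mono)
      also have "\<dots> \<le> (\<Sum>i<N. \<bar>f i\<bar> * real i powr r)"
        by (rule member_le_sum) (use False in auto)
      finally show ?thesis by (simp add: B_def)
    qed
    then show ?thesis using pos by (simp add: powr_minus field_simps)
  qed
  then show ?thesis by blast
qed

section \<open>Differentiable trajectories with Hoelder continuous derivative\<close>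

theorem theorem2p7:
  fixes M :: "'a measure"
    and Y Y' :: "nat \<Rightarrow> 'a \<Rightarrow> real"
    and c :: "nat \<Rightarrow> real"
    and x :: "real \<Rightarrow> 'a \<Rightarrow> real"
    and \<alpha> :: real
  assumes "prob_space M"
    and "iid_std_gaussian_seq M Y"
    and "iid_std_gaussian_seq M Y'"
    and "indep_seqs M Y Y'"
    and "summable (\<lambda>k. (c k)\<^sup>2)"
    and "process_class_H M x"
    and "ms_uniform_limit M {0..1} (fourier_partial_sum c Y Y') x"
    and "0 < \<alpha>" and "\<alpha> \<le> 1"
    and "(\<lambda>k. (c k)\<^sup>2) \<in> O(\<lambda>k. 1 / real k powr (3 + \<alpha>))"
  shows "\<exists>y y'. modification M {0..1} x y \<and>
    (\<forall>t\<in>{0..1}. y' t \<in> borel_measurable M) \<and>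
    (AE \<omega> in M.
       (\<exists>L. L-lipschitz_on {0..1} (\<lambda>t. y t \<omega>)) \<and>
       (\<forall>t\<in>{0..1}. ((\<lambda>s. y s \<omega>) has_real_derivative y' t \<omega>) (at t within {0..1})) \<and>
       continuous_on {0..1} (\<lambda>t. y' t \<omega>) \<and>
       (\<forall>\<beta>. 0 < \<beta> \<and> \<beta> < \<alpha> / 2 \<longrightarrow> holder_on \<beta> {0..1} (\<lambda>t. y' t \<omega>)))"
proof -
  note [measurable] = iid_std_gaussian_seq_measurable[OF assms(2)] iid_std_gaussian_seq_measurable[OF assms(3)]
  define a where "a = (\<lambda>k. sqrt 2 * c k)"
  obtain B where B: "\<forall>k\<ge>1. (c k)\<^sup>2 \<le> B * real k powr - (3 + \<alpha>)"
    using bigo_inverse_powr_imp_bound[OF assms(10)] by blast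
  have a: "\<forall>k\<ge>1. (a k)\<^sup>2 \<le> 2 * B * real k powr - (3 + \<alpha>)"
    using B by (simp add: a_def power_mult_distrib)
  define U where "U \<omega> = trig_block a 0 (\<lambda>k. Y k \<omega>)" for \<omega>
  define V where "V \<omega> = trig_block a (pi / 2) (\<lambda>k. Y' k \<omega>)" for \<omega>
  define U' where "U' \<omega> = trig_block (freq_mult a) (0 + pi / 2) (\<lambda>k. Y k \<omega>)" for \<omega>
  define V' where "V' \<omega> = trig_block (freq_mult a) (pi / 2 + pi / 2) (\<lambda>k. Y' k \<omega>)" for \<omega>
  have [measurable]: "(\<lambda>\<omega>. U \<omega> j t) \<in> borel_measurable M" "(\<lambda>\<omega>. V \<omega> j t) \<in> borel_measurable M"
    "(\<lambda>\<omega>. U' \<omega> j t) \<in> borel_measurable M" "(\<lambda>\<omega>. V' \<omega> j t) \<in> borel_measurable M" for j t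
    unfolding U_def V_def U'_def V'_def by measurable
  define y where "y t \<omega> = c 0 * Y' 0 \<omega> + (\<Sum>j. U \<omega> j t) + (\<Sum>j. V \<omega> j t)" for t \<omega>
  define y' where "y' t \<omega> = (\<Sum>j. U' \<omega> j t) + (\<Sum>j. V' \<omega> j t)" for t \<omega>
  have y_meas [measurable]: "y t \<in> borel_measurable M" for t unfolding y_def by measurable
  have y'_meas: "y' t \<in> borel_measurable M" for t unfolding y'_def by measurable
  have "\<alpha> \<le> 2" using assms(9) by simp
  note series_U = AE_trig_block_series_C1_holder[OF assms(1,2) a assms(8) this, of 0, folded U_def U'_def]
  note series_V = AE_trig_block_series_C1_holder[OF assms(1,3) a assms(8) \<open>\<alpha> \<le> 2\<close>, of "pi / 2", folded V_def V'_def]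
  have "AE \<omega> in M. y t \<omega> = x t \<omega>" if t: "t \<in> {0..1}" for t
  proof (rule AE_eq_of_mean_square_limit)
    show "x t \<in> borel_measurable M"
      using assms(6) t by (simp add: process_class_H_def gaussian_process_def)
    show "fourier_partial_sum c Y Y' (2 ^ n - 1) t \<in> borel_measurable M" for n
      unfolding fourier_partial_sum_def by measurable
    have "filterlim (\<lambda>n::nat. 2 ^ n - 1 :: nat) at_top sequentially"
    proof (rule filterlim_at_top_mono[OF filterlim_ident])
      show "\<forall>\<^sub>F n in sequentially. n \<le> 2 ^ n - (1::nat)"
        by (intro always_eventually allI) (metis Suc_leI Suc_pred' less_exp less_Suc_eq_le pos2 zero_less_power diff_Suc_1 diff_le_mono)
    qed
    then show "(\<lambda>n. \<integral>\<^sup>+\<omega>. ennreal ((x t \<omega> - fourier_partial_sum c Y Y' (2 ^ n - 1) t \<omega>)\<^sup>2) \<partial>M) \<longlonglongrightarrow> 0"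
      by (rule filterlim_compose[OF ms_uniform_limit_imp_pointwise[OF assms(7) t]])
    show "AE \<omega> in M. (\<lambda>n. fourier_partial_sum c Y Y' (2 ^ n - 1) t \<omega>) \<longlonglongrightarrow> y t \<omega>"
      using series_U(1) series_V(1)
    proof eventually_elim
      case (elim \<omega>)
      then have "(\<lambda>n. \<Sum>j<n. U \<omega> j t) \<longlonglongrightarrow> (\<Sum>j. U \<omega> j t)" "(\<lambda>n. \<Sum>j<n. V \<omega> j t) \<longlonglongrightarrow> (\<Sum>j. V \<omega> j t)"
        using t by (auto intro: summable_LIMSEQ)
      then show ?case
        unfolding y_def fourier_partial_sum_dyadic a_def[symmetric] U_def[symmetric] V_def[symmetric]
        by (intro tendsto_intros)
    qed
  qed measurable
  then have "modification M {0..1} x y" by (simp add: modification_def)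
  moreover have "AE \<omega> in M.
       (\<exists>L. L-lipschitz_on {0..1} (\<lambda>t. y t \<omega>)) \<and>
       (\<forall>t\<in>{0..1}. ((\<lambda>s. y s \<omega>) has_real_derivative y' t \<omega>) (at t within {0..1})) \<and>
       continuous_on {0..1} (\<lambda>t. y' t \<omega>) \<and>
       (\<forall>\<beta>. 0 < \<beta> \<and> \<beta> < \<alpha> / 2 \<longrightarrow> holder_on \<beta> {0..1} (\<lambda>t. y' t \<omega>))"
    using series_U series_V
  proof eventually_elim
    case (elim \<omega>)
    have deriv: "((\<lambda>s. y s \<omega>) has_real_derivative y' t \<omega>) (at t within {0..1})" if "t \<in> {0..1}" for t
    proof -
      have "((\<lambda>s. c 0 * Y' 0 \<omega> + (\<Sum>j. U \<omega> j s) + (\<Sum>j. V \<omega> j s)) has_real_derivative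
          0 + (\<Sum>j. U' \<omega> j t) + (\<Sum>j. V' \<omega> j t)) (at t within {0..1})"
        using elim that by (intro DERIV_add DERIV_const) auto
      then show ?thesis by (simp add: y_def y'_def)
    qed
    have holder: "holder_on \<beta> {0..1} (\<lambda>t. y' t \<omega>)" if "0 < \<beta>" "\<beta> < \<alpha> / 2" for \<beta>
      unfolding y'_def using elim that by (intro holder_on_add) auto
    have cont: "continuous_on {0..1} (\<lambda>t. y' t \<omega>)"
      by (rule holder_on_imp_continuous_on[OF holder[of "\<alpha> / 4"]]) (use assms(8) in auto)
    have "\<exists>L. L-lipschitz_on {0..1} (\<lambda>t. y t \<omega>)"
      by (rule C1_imp_lipschitz_on[OF deriv cont]) auto
    with deriv holder cont show ?case by blast
  qed
  ultimately show ?thesis using y'_meas by blast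
qed

end
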